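(* In the setting described in the context (a phase space $\mathcal{B}$ satisfying assumption (A) with function $K$, linear operators $A_m:\mathcal{B}\to X$, projections $P_n$ on $\mathcal{B}$ compatible with the evolution family $\mathcal{A}(m,n)$, the Green operator $\mathcal{G}$, and nonlinearities $f_m:\mathcal{B}\to X$ with $f_m(0)=0$ and $|f_m(\phi)-f_m(\psi)|\le c_m\min(1,\|\phi-\psi\|_{\mathcal{B}})$, $c_m>0$), assume that $$q:=\sup_{m\in\mathbb{Z}^+}\Big(\sum_{n\in\mathbb{Z}^+}c_n\,\|\mathcal{G}(m,n+1)\|\Big)\quad\text{satisfies}\quad K(1)\,q<1 .$$ Then there exists a function $\eta\in\mathcal{M}$ such that, writing $\eta^n=\eta(n,\cdot)$ and $h^n=\mathrm{Id}_{F_n}+\eta^n:F_n\to\mathcal{B}$, for every $m\ge n\ge 0$ $$h^m\circ\mathcal{A}(m,n)=\mathcal{R}(m,n)\circ h^n\quad\text{on }F_n .$$ Moreover, each map $h^n$ is one-to-one provided that the condition $K(1)\,\sup_{m\in\mathbb{Z}^+}\big(\sum_{n\in\mathbb{Z}^+}c_n\,\|\mathcal{G}(m,n+1)\|\big)<1$ holds with a constant sequence $(c_n)_{n\in\mathbb{Z}^+}$.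
   Context: $\mathbb{Z}^+$ and $\mathbb{Z}^-$ denote the sets of nonnegative and nonpositive integers. $(X,|\cdot|)$ is a Banach space. For $x:\mathbb{Z}\to X$ and $m\in\mathbb{Z}$, define $x_m:\mathbb{Z}^-\to X$ by $x_m(j)=x(m+j)$. Phase space: $(\mathcal{B},\|\cdot\|_{\mathcal{B}})$ is a Banach space of sequences $\phi:\mathbb{Z}^-\to X$ satisfying assumption (A): there exist $J>0$ and $K,M:\mathbb{Z}^+\to[0,\infty)$ such that if $x:\mathbb{Z}\to X$ has $x_0\in\mathcal{B}$, then for all $n\in\mathbb{Z}^+$, $x_n\in\mathcal{B}$ and $J|x(n)|\le\|x_n\|_{\mathcal{B}}\le K(n)\sup_{0\le j\le n}|x(j)|+M(n)\|x_0\|_{\mathcal{B}}$. Such $J,K,M$ are fixed. Linear equation: $A_m:\mathcal{B}\to X$, $m\in\mathbb{Z}^+$, are linear operators, and one considers $x(m+1)=A_mx_m$, $m\in\mathbb{Z}^+$. For $(n,\phi)\in\mathbb{Z}^+\times\mathcal{B}$ let $x(\cdot;n,\phi):\mathbb{Z}\to X$ be the unique sequence with $x_n=\phi$ satisfying the equation for all $m\ge n$. For $m\ge n\ge0$ define $\mathcal{A}(m,n):\mathcal{B}\to\mathcal{B}$ by $\mathcal{A}(m,n)\phi=x_m(\cdot;n,\phi)$. Projections: $(P_n)_{n\in\mathbb{Z}^+}$ is a sequence of projections on $\mathcal{B}$ such that $P_m\mathcal{A}(m,n)=\mathcal{A}(m,n)P_n$ for $m\ge n\ge0$ and $\mathcal{A}(m,n)|_{\ker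 P_n}:\ker P_n\to\ker P_m$ is invertible for $m\ge n\ge0$. For $n\ge m\ge0$, $\mathcal{A}(m,n):=(\mathcal{A}(n,m)|_{\ker P_m})^{-1}:\ker P_n\to\ker P_m$. Put $Q_n=\mathrm{Id}_{\mathcal{B}}-P_n$ and let $F_n$ be the range of $Q_n$ (so $F_n=\ker P_n$). Green operator: for $m,n\in\mathbb{Z}^+$, $\mathcal{G}(m,n)=\mathcal{A}(m,n)P_n$ if $m\ge n$, and $\mathcal{G}(m,n)=-\mathcal{A}(m,n)Q_n$ if $m<n$. $\|\mathcal{G}(m,n)\|$ is the operator norm on $\mathcal{B}$. Space $\mathcal{M}$: the set of continuous functions $\eta:\{(n,\phi):n\in\mathbb{Z}^+,\phi\in F_n\}\to\mathcal{B}$ with $\|\eta\|_\infty:=\sup\{\|\eta(n,\phi)\|_{\mathcal{B}}:n\in\mathbb{Z}^+,\phi\in F_n\}<\infty$. Semilinear equation: $f_m:\mathcal{B}\to X$, $m\in\mathbb{Z}^+$, are maps with $f_m(0)=0$, and $c_m>0$ are numbers with $|f_m(\phi)-f_m(\psi)|\le c_m\min(1,\|\phi-\psi\|_{\mathcal{B}})$ for all $m\in\mathbb{Z}^+$, $\phi,\psi\in\mathcal{B}$. One considers $x(m+1)=A_mx_m+f_m(x_m)$, $m\in\mathbb{Z}^+$. For $m\ge n\ge0$, $\mathcal{R}(m,n):\mathcal{B}\to\mathcal{B}$ is its solution operator: $\mathcal{R}(m,n)\phi=x_m$, where $x:\mathbb{Z}\to X$ is the unique sequence with $x_n=\phi$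 satisfying the semilinear equation at all indices $\ge n$. *)

theory Defs
  imports "HOL-Analysis.Analysis"
begin

text \<open>
  A sequence on the nonpositive integers is a function on \<^typ>\<open>nat\<close> whose value at \<open>k\<close> is the
  entry with index \<open>-k\<close>.  Thus \<open>hist x m\<close> is the sequence \<open>x\<^sub>m\<close> with \<open>x\<^sub>m(j) = x(m + j)\<close>, \<open>j \<le> 0\<close>.
\<close>

definition hist :: "(int \<Rightarrow> 'a) \<Rightarrow> nat \<Rightarrow> nat \<Rightarrow> 'a" where
  "hist x m k = x (int m - int k)"

text \<open>
  A Banach space of sequences is a Banach space \<^typ>\<open>'b\<close> together with the map \<open>entries\<close> sending
  each element to the sequence that it is.  Vector space operations are entrywise, and distinct
  elements are distinct sequences; the sequences belonging to the space are those in
  \<open>range entries\<close>.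
\<close>

definition sequence_space :: "('b::banach \<Rightarrow> nat \<Rightarrow> 'a::banach) \<Rightarrow> bool" where
  "sequence_space entries \<longleftrightarrow> inj entries \<and> (\<forall>k. linear (\<lambda>\<phi>. entries \<phi> k))"

text \<open>The element of the phase space given by \<open>x\<^sub>m\<close> (meaningful when \<open>x\<^sub>m\<close> belongs to the space).\<close>

definition segment :: "('b \<Rightarrow> nat \<Rightarrow> 'a) \<Rightarrow> (int \<Rightarrow> 'a) \<Rightarrow> nat \<Rightarrow> 'b" where
  "segment entries x m = inv entries (hist x m)"

definition phase_space ::
  "('b::banach \<Rightarrow> nat \<Rightarrow> 'a::banach) \<Rightarrow> real \<Rightarrow> (nat \<Rightarrow> real) \<Rightarrow> (nat \<Rightarrow> real) \<Rightarrow> bool" where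
  "phase_space entries J K M \<longleftrightarrow>
     sequence_space entries \<and> J > 0 \<and> (\<forall>n. K n \<ge> 0) \<and> (\<forall>n. M n \<ge> 0) \<and>
     (\<forall>x. hist x 0 \<in> range entries \<longrightarrow>
       (\<forall>n. hist x n \<in> range entries \<and>
            J * norm (x (int n)) \<le> norm (segment entries x n) \<and>
            norm (segment entries x n)
              \<le> K n * (SUP j\<in>{0..n}. norm (x (int j))) + M n * norm (segment entries x 0)))"

text \<open>The solution of \<open>x(m+1) = g\<^sub>m(x\<^sub>m)\<close>, \<open>m \<ge> n\<close>, with \<open>x\<^sub>n = \<phi>\<close>.\<close>

definition solution ::
  "('b \<Rightarrow> nat \<Rightarrow> 'a) \<Rightarrow> (nat \<Rightarrow> 'b \<Rightarrow> 'a) \<Rightarrow> nat \<Rightarrow> 'b \<Rightarrow> int \<Rightarrow> 'a" where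
  "solution entries g n \<phi> =
     (THE x. hist x n = entries \<phi> \<and>
             (\<forall>m\<ge>n. x (int m + 1) = g m (segment entries x m)))"

definition sol_op ::
  "('b \<Rightarrow> nat \<Rightarrow> 'a) \<Rightarrow> (nat \<Rightarrow> 'b \<Rightarrow> 'a) \<Rightarrow> nat \<Rightarrow> nat \<Rightarrow> 'b \<Rightarrow> 'b" where
  "sol_op entries g m n \<phi> = segment entries (solution entries g n \<phi>) m"

definition semilinear_op ::
  "('b \<Rightarrow> nat \<Rightarrow> 'a::plus) \<Rightarrow> (nat \<Rightarrow> 'b \<Rightarrow> 'a) \<Rightarrow> (nat \<Rightarrow> 'b \<Rightarrow> 'a) \<Rightarrow> nat \<Rightarrow> nat \<Rightarrow> 'b \<Rightarrow> 'b" where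
  "semilinear_op entries A f = sol_op entries (\<lambda>m \<phi>. A m \<phi> + f m \<phi>)"

definition ker :: "('b \<Rightarrow> 'b::zero) \<Rightarrow> 'b set" where
  "ker T = {\<phi>. T \<phi> = 0}"

definition compl_proj :: "(nat \<Rightarrow> 'b \<Rightarrow> 'b::minus) \<Rightarrow> nat \<Rightarrow> 'b \<Rightarrow> 'b" where
  "compl_proj P n \<phi> = \<phi> - P n \<phi>"

definition compl_space :: "(nat \<Rightarrow> 'b \<Rightarrow> 'b::minus) \<Rightarrow> nat \<Rightarrow> 'b set" where
  "compl_space P n = range (compl_proj P n)"

text \<open>
  The linear evolution operators \<open>\<A>(m,n)\<close>; for \<open>m < n\<close> this is meaningful on \<open>ker (P n)\<close> only.
\<close>

definition lin_op ::
  "('b \<Rightarrow> nat \<Rightarrow> 'a) \<Rightarrow> (nat \<Rightarrow> 'b \<Rightarrow> 'a) \<Rightarrow> (nat \<Rightarrow> 'b \<Rightarrow> 'b::zero) \<Rightarrow> nat \<Rightarrow> nat \<Rightarrow> 'b \<Rightarrow> 'b" where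
  "lin_op entries A P m n =
     (if n \<le> m then sol_op entries A m n else inv_into (ker (P m)) (sol_op entries A n m))"

definition green ::
  "('b \<Rightarrow> nat \<Rightarrow> 'a) \<Rightarrow> (nat \<Rightarrow> 'b \<Rightarrow> 'a) \<Rightarrow> (nat \<Rightarrow> 'b \<Rightarrow> 'b::ab_group_add) \<Rightarrow>
     nat \<Rightarrow> nat \<Rightarrow> 'b \<Rightarrow> 'b" where
  "green entries A P m n \<phi> =
     (if n \<le> m then lin_op entries A P m n (P n \<phi>)
      else - lin_op entries A P m n (compl_proj P n \<phi>))"

text \<open>
  The operator norm with values in \<open>[0,\<infinity>]\<close>, infinite exactly for unbounded operators.
  For bounded linear operators it agrees with \<^const>\<open>onorm\<close>, whose value is unspecified
  for unbounded ones.
\<close>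

definition op_norm :: "('b::real_normed_vector \<Rightarrow> 'b) \<Rightarrow> ennreal" where
  "op_norm T = (SUP \<phi>. ennreal (norm (T \<phi>) / norm \<phi>))"

definition green_sup ::
  "('b::real_normed_vector \<Rightarrow> nat \<Rightarrow> 'a) \<Rightarrow> (nat \<Rightarrow> 'b \<Rightarrow> 'a) \<Rightarrow> (nat \<Rightarrow> 'b \<Rightarrow> 'b) \<Rightarrow>
     (nat \<Rightarrow> real) \<Rightarrow> ennreal" where
  "green_sup entries A P c =
     (SUP m. \<Sum>n. ennreal (c n) * op_norm (green entries A P m (n + 1)))"

text \<open>
  The space of bounded continuous functions on \<open>{(n,\<phi>). \<phi> \<in> F\<^sub>n}\<close>.  Elements are functions on
  the whole type, but only their values on this set matter.
\<close>

definition bcont_space :: "(nat \<Rightarrow> 'b::real_normed_vector \<Rightarrow> 'b) \<Rightarrow> (nat \<times> 'b \<Rightarrow> 'b) set" where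
  "bcont_space P =
     {\<eta>. continuous_on (SIGMA n:UNIV. compl_space P n) \<eta> \<and>
         bounded (\<eta> ` (SIGMA n:UNIV. compl_space P n))}"

end

theory Submission
  imports Defs
begin

text \<open>
  The conjugacy is found as a fixed point.  Write \<open>F\<^sub>n\<close> for the kernel of \<open>P\<^sub>n\<close>, \<open>\<Gamma> v\<close> for the
  history with present value \<open>v\<close> and zero past, and \<open>\<A>\<close>, \<open>\<R>\<close> for the linear and semilinear
  solution operators.  Variation of constants says that
  \<open>\<R>(m+1,m) \<psi> = \<A>(m+1,m) \<psi> + \<Gamma> f\<^sub>m(\<psi>)\<close>.  A sequence
  \<open>u\<^sub>m = \<A>(m,n) \<phi> + \<Sum>\<^sub>k \<G>(m,k+1) g\<^sub>k\<close> with \<open>\<phi> \<in> F\<^sub>n\<close> satisfies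
  \<open>u\<^sub>m\<^sub>+\<^sub>1 = \<A>(m+1,m) u\<^sub>m + g\<^sub>m\<close>, because applying \<open>\<A>(m+1,m)\<close> to \<open>\<G>(m,k+1)\<close> gives
  \<open>\<G>(m+1,k+1)\<close>, up to the jump \<open>Id\<close> at \<open>k = m\<close> (\<open>W_green_Suc\<close>, \<open>green_series_step\<close>).  Hence \<open>u\<close>
  solves the semilinear equation as soon as \<open>g\<^sub>k = \<Gamma> f\<^sub>k(u\<^sub>k)\<close>, which for
  \<open>u\<^sub>k = h\<^sup>k(\<A>(k,n) \<phi>)\<close> is the equation
  \<open>\<eta>(n,\<phi>) = \<Sum>\<^sub>k \<G>(n,k+1) \<Gamma> f\<^sub>k(\<A>(k,n) \<phi> + \<eta>(k,\<A>(k,n) \<phi>))\<close> on \<open>F\<^sub>n\<close>.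
  Since \<open>\<parallel>\<Gamma> v\<parallel> \<le> K(1) \<bar>v\<bar>\<close>, its right-hand side maps bounded continuous functions to such functions
  and is a contraction with constant \<open>K(1) q < 1\<close>.

  Continuity of the right-hand side needs \<open>\<A>(k,n)\<close> to be continuous on \<open>F\<^sub>n\<close>, although the operators
  \<open>A\<^sub>m\<close> may be unbounded.  For \<open>k < n\<close> this is the finiteness of the norm of \<open>\<G>(k,n)\<close>.  For
  \<open>k > n\<close> the operator is the inverse of a bounded bijection between the closed subspaces \<open>F\<^sub>k\<close> and
  \<open>F\<^sub>n\<close>, so that the open mapping principle applies (\<open>bounded_linear_preimage_bound\<close>,
  \<open>bounded_linear_V\<close>).

  For injectivity let \<open>h\<^sup>n(\<phi>) = h\<^sup>n(\<psi>)\<close>.  The conjugacy gives \<open>h\<^sup>m(\<A>(m,n) \<phi>) = h\<^sup>m(\<A>(m,n) \<psi>)\<close>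
  for all \<open>m \<ge> n\<close>, so \<open>w = \<phi> - \<psi>\<close> has a bounded forward orbit.  But
  \<open>w = - \<G>(n,m) \<A>(m,n) w\<close> for \<open>m > n\<close>, and the smallness condition for a constant
  sequence makes the norms of \<open>\<G>(n,m)\<close> summable over \<open>m\<close>, so they tend to 0 and \<open>w = 0\<close>
  (\<open>bounded_orbit_zero\<close>).

  In the degenerate case \<open>K(1) = 0\<close> the smallness condition carries no information, but then
  \<open>\<Gamma> = 0\<close> and the whole phase space is trivial.
\<close>

section \<open>Surjections between Banach spaces\<close>

text \<open>
  The open mapping theorem for an operator with closed range, in quantitative form.  By Baire, the
  closure of the image of some ball contains a ball of the range; by linearity each \<open>y\<close> in the range
  is then matched up to half its norm by an image \<open>T x\<close> with \<open>\<parallel>x\<parallel> \<le> L \<parallel>y\<parallel>\<close>.  Correcting the error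
  again and again yields a geometric series whose sum is an exact preimage.
\<close>

lemma bounded_linear_preimage_bound:
  fixes T :: "'b::banach \<Rightarrow> 'c::banach"
  assumes T: "bounded_linear T" and closed_range: "closed (range T)"
  shows "\<exists>C. \<forall>y\<in>range T. \<exists>x. T x = y \<and> norm x \<le> C * norm y"
proof -
  interpret T: bounded_linear T by (fact T)
  define F where "F = range T"
  have sF: "subspace F"
    unfolding F_def by (intro linear_subspace_image subspace_UNIV) (rule T.linear)
  define B where "B N = closure (T ` ball 0 (real N))" for N :: nat
  have BF: "B N \<subseteq> F" for N
    unfolding B_def F_def by (intro closure_minimal closed_range) auto
  have "F \<subseteq> (\<Union>N. B N)"
  proof
    fix y assume "y \<in> F"
    then obtain x where x: "y = T x" unfolding F_def by auto
    obtain N :: nat where "norm x < real N" using reals_Archimedean2 by blast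
    then have "y \<in> T ` ball 0 (real N)" using x by (intro image_eqI[of _ _ x]) auto
    then have "y \<in> B N" unfolding B_def by (rule subsetD[OF closure_subset])
    then show "y \<in> (\<Union>N. B N)" by (rule UN_I[OF UNIV_I])
  qed
  then have cover: "(\<Union>N. B N) = F" using BF by (intro equalityI UN_least)
  \<comment> \<open>Baire in the complete space \<open>F\<close>, which is the union of the closed sets \<open>B N\<close>\<close>
  have "\<exists>N. top_of_set F interior_of B N \<noteq> {}"
  proof (rule ccontr)
    assume "\<nexists>N. top_of_set F interior_of B N \<noteq> {}"
    then have empty: "\<And>N. top_of_set F interior_of B N = {}" by blast
    have "top_of_set F interior_of \<Union>(range B) = {}"
    proof (rule Baire_category_alt)
      have "completely_metrizable_space (top_of_set F)"
        unfolding F_def using closed_range completely_metrizable_space_closedin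
          completely_metrizable_space_euclidean by (metis closed_closedin)
      then show "completely_metrizable_space (top_of_set F) \<or>
          locally_compact_space (top_of_set F) \<and> regular_space (top_of_set F)" by blast
      show "closedin (top_of_set F) S \<and> top_of_set F interior_of S = {}" if "S \<in> range B" for S
        using that empty BF by (auto intro!: closed_subset simp: B_def)
    qed simp
    then have "F = {}" using cover interior_of_topspace[of "top_of_set F"] by simp
    then show False unfolding F_def by blast
  qed
  then obtain N y0 where "y0 \<in> top_of_set F interior_of B N" by blast
  then obtain S where S: "openin (top_of_set F) S" "y0 \<in> S" "S \<subseteq> B N"
    unfolding interior_of_def by blast
  then obtain r where r: "r > 0" and near: "\<And>y. y \<in> F \<Longrightarrow> dist y y0 < r \<Longrightarrow> y \<in> B N"
    and y0: "y0 \<in> F"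
    unfolding openin_euclidean_subtopology_iff by blast
  \<comment> \<open>a small \<open>y\<close> is the difference of the two points \<open>y0 + y\<close> and \<open>y0\<close> of \<open>B N\<close>\<close>
  have approx_small: "\<exists>x. norm x \<le> 2 * real N \<and> norm (y - T x) < e"
    if "y \<in> F" "norm y < r" "e > 0" for y e
  proof -
    have "y0 + y \<in> F" using sF y0 that(1) by (rule subspace_add)
    then have N: "y0 + y \<in> closure (T ` ball 0 (real N))"
      by (intro near[unfolded B_def]) (use that(2) in \<open>simp_all add: dist_norm\<close>)
    have N0: "y0 \<in> closure (T ` ball 0 (real N))"
      using near[OF y0] r by (simp add: B_def)
    have e: "e / 2 > 0" using \<open>e > 0\<close> by simp
    obtain a where a: "norm a < real N" "dist (T a) (y0 + y) < e/2"
      using N[unfolded closure_approachable, rule_format, OF e] by auto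
    obtain b where b: "norm b < real N" "dist (T b) y0 < e/2"
      using N0[unfolded closure_approachable, rule_format, OF e] by auto
    have eq: "y - T (a - b) = (T b - y0) - (T a - (y0 + y))" by (simp add: T.diff)
    have "norm (a - b) \<le> 2 * real N" using a(1) b(1) norm_triangle_ineq4[of a b] by linarith
    moreover have "norm (y - T (a - b)) < e"
      using a(2) b(2) norm_triangle_ineq4[of "T b - y0" "T a - (y0 + y)"]
      unfolding eq dist_norm by linarith
    ultimately show ?thesis by blast
  qed
  define L where "L = 4 * real N / r"
  have L: "L \<ge> 0" unfolding L_def using r by simp
  have approx: "\<exists>x. norm x \<le> L * norm y \<and> norm (y - T x) \<le> norm y / 2" if y: "y \<in> F" for y
  proof (cases "y = 0")
    case True
    then show ?thesis by (intro exI[of _ 0]) (simp add: T.zero)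
  next
    case False
    \<comment> \<open>scales \<open>y\<close> to norm \<open>r / 2\<close>, inside the ball where images are dense\<close>
    define t where "t = r / (2 * norm y)"
    have t: "t > 0" unfolding t_def using r False by simp
    have "t *\<^sub>R y \<in> F" using sF y by (rule subspace_scale)
    moreover have "norm (t *\<^sub>R y) < r" unfolding t_def using r False by simp
    moreover have "t * norm y / 2 > 0" using t False by simp
    ultimately obtain x where x: "norm x \<le> 2 * real N" "norm (t *\<^sub>R y - T x) < t * norm y / 2"
      using approx_small by blast
    have "norm (x /\<^sub>R t) \<le> L * norm y"
    proof -
      have "norm (x /\<^sub>R t) = norm x / t" using t by (simp add: divide_inverse_commute)
      also have "\<dots> \<le> 2 * real N / t" using x(1) t by (simp add: divide_right_mono)
      also have "\<dots> = L * norm y" unfolding L_def t_def using r False by (simp add: field_simps)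
      finally show ?thesis .
    qed
    moreover have "y - T (x /\<^sub>R t) = (t *\<^sub>R y - T x) /\<^sub>R t"
      using t by (simp add: T.scaleR scaleR_diff_right)
    then have "norm (y - T (x /\<^sub>R t)) = norm (t *\<^sub>R y - T x) / t"
      using t by (simp add: divide_inverse_commute)
    then have "norm (y - T (x /\<^sub>R t)) \<le> norm y / 2"
      using x(2) t by (simp add: pos_divide_le_eq mult.commute)
    ultimately show ?thesis by blast
  qed
  then obtain g where g: "\<And>y. y \<in> F \<Longrightarrow> norm (g y) \<le> L * norm y"
      "\<And>y. y \<in> F \<Longrightarrow> norm (y - T (g y)) \<le> norm y / 2"
    by metis
  have "\<exists>x. T x = y \<and> norm x \<le> 2 * L * norm y" if y: "y \<in> F" for y
  proof -
    \<comment> \<open>the part of \<open>y\<close> not yet matched after \<open>k\<close> corrections\<close>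
    define z where "z = rec_nat y (\<lambda>_ w. w - T (g w))"
    have z0: "z 0 = y" and zS: "z (Suc k) = z k - T (g (z k))" for k
      unfolding z_def by auto
    have zF: "z k \<in> F" for k
    proof (induction k)
      case (Suc k)
      then show ?case unfolding zS by (intro subspace_diff[OF sF]) (auto simp: F_def)
    qed (simp add: z0 y)
    have zbd: "norm (z k) \<le> norm y * (1/2)^k" for k
    proof (induction k)
      case (Suc k)
      then show ?case unfolding zS using g(2)[OF zF[of k]] by (simp add: zS)
    qed (simp add: z0)
    have gbd: "norm (g (z k)) \<le> L * norm y * (1/2)^k" for k
      using g(1)[OF zF[of k]] mult_left_mono[OF zbd[of k] L] by (simp add: mult.assoc)
    have geo: "(\<lambda>k. L * norm y * (1/2)^k) sums (L * norm y * 2)"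
      using geometric_sums[of "1/2::real"] by (intro sums_mult) simp
    have sg: "summable (\<lambda>k. norm (g (z k)))"
      by (rule summable_comparison_test'[OF sums_summable[OF geo], of 0]) (use gbd in auto)
    have "(\<lambda>k. T (g (z k))) sums T (\<Sum>k. g (z k))"
      using T.sums summable_norm_cancel[OF sg] summable_sums by blast
    moreover have "(\<lambda>k. T (g (z k))) sums y"
    proof -
      have lim: "z \<longlonglongrightarrow> 0"
      proof (rule tendsto_norm_zero_cancel, rule tendsto_sandwich[of "\<lambda>_. 0"])
        have "(\<lambda>k. norm y * (1/2)^k) \<longlonglongrightarrow> norm y * 0"
          by (intro tendsto_mult tendsto_const LIMSEQ_realpow_zero) auto
        then show "(\<lambda>k. norm y * (1/2)^k) \<longlonglongrightarrow> 0" by simp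
      qed (use zbd in auto)
      have "(\<lambda>k. z k - z (Suc k)) sums (z 0 - 0)" by (rule telescope_sums'[OF lim])
      then show ?thesis by (simp add: zS z0)
    qed
    ultimately have "T (\<Sum>k. g (z k)) = y" by (rule sums_unique2)
    moreover have "norm (\<Sum>k. g (z k)) \<le> (\<Sum>k. norm (g (z k)))" by (rule summable_norm[OF sg])
    moreover have "\<dots> \<le> L * norm y * 2"
      using suminf_le[OF gbd sg sums_summable[OF geo]] sums_unique[OF geo] by simp
    ultimately show ?thesis by (intro exI[of _ "\<Sum>k. g (z k)"]) (auto simp: mult_ac)
  qed
  then show ?thesis unfolding F_def by blast
qed

section \<open>Continuous functions and operator norms\<close>

lemma continuous_on_nat_prod:
  fixes g :: "nat \<times> 'b::topological_space \<Rightarrow> 'c::topological_space"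
  assumes "\<And>n. continuous_on UNIV (\<lambda>\<phi>. g (n, \<phi>))"
  shows "continuous_on UNIV g"
proof -
  have "open (({n} :: nat set) \<times> (UNIV :: 'b set))" for n
    by (intro open_Times) (auto simp: open_discrete)
  moreover have "continuous_on ({n} \<times> UNIV) g" for n
  proof -
    have "continuous_on ({n} \<times> UNIV) ((\<lambda>\<phi>. g (n, \<phi>)) \<circ> snd)"
      by (intro continuous_on_compose continuous_intros continuous_on_subset[OF assms]) auto
    then show ?thesis by (rule continuous_on_eq) auto
  qed
  ultimately have "continuous_on (\<Union>n. {n} \<times> UNIV) g"
    by (intro continuous_on_open_UN) auto
  moreover have "(\<Union>n. {n} \<times> UNIV) = (UNIV :: (nat \<times> 'b) set)" by auto
  ultimately show ?thesis by simp
qed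

lemma op_norm_le:
  assumes "linear T" "op_norm T < top"
  shows "norm (T x) \<le> enn2real (op_norm T) * norm x"
proof (cases "x = 0")
  case True
  then show ?thesis using linear_0[OF assms(1)] by simp
next
  case False
  have "ennreal (norm (T x) / norm x) \<le> op_norm T"
    unfolding op_norm_def by (rule SUP_upper) simp
  then have "norm (T x) / norm x \<le> enn2real (op_norm T)"
    using assms(2) by (metis enn2real_ennreal enn2real_mono divide_nonneg_nonneg norm_ge_zero)
  then show ?thesis using False by (simp add: field_simps)
qed

lemma bounded_linear_if_op_norm_finite:
  assumes "linear T" "op_norm T < top"
  shows "bounded_linear T"
  using op_norm_le[OF assms] assms(1)
  by (intro bounded_linear.intro bounded_linear_axioms.intro)
     (auto intro!: exI[of _ "enn2real (op_norm T)"] simp: mult.commute linear_linear)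

lemma ennreal_mult_less_one_finite:
  assumes "ennreal a * x < 1" "a > 0"
  shows "x < top" and "a * enn2real x < 1"
proof -
  show x: "x < top"
  proof (rule ccontr)
    assume "\<not> x < top"
    then have "x = top" using top.not_eq_extremum by blast
    then show False using assms by (simp add: ennreal_mult_top)
  qed
  then obtain r where r: "x = ennreal r" "r \<ge> 0" by (cases x) auto
  then have "ennreal (a * r) < ennreal 1" using assms by (simp add: ennreal_mult)
  then show "a * enn2real x < 1" using r assms by (subst (asm) ennreal_less_iff) auto
qed

text \<open>
  A Cauchy sequence converges uniformly, and uniform limits of bounded continuous functions are
  bounded and continuous.  No metric on the domain is involved, so that \<^typ>\<open>nat\<close> with its discrete
  topology can be one of its factors.
\<close>

lemma complete_bcontfun:
  "complete (UNIV :: ('a::topological_space \<Rightarrow>\<^sub>C 'b::complete_space) set)"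
proof (rule completeI)
  fix u :: "nat \<Rightarrow> 'a \<Rightarrow>\<^sub>C 'b"
  assume cauchy: "Cauchy u"
  have "\<exists>N. \<forall>m n x. N \<le> m \<and> N \<le> n \<and> True \<longrightarrow> dist (u m x) (u n x) < e" if "e > 0" for e
    using cauchy that unfolding Cauchy_def by (blast intro: dist_fun_lt_imp_dist_val_lt)
  then obtain l where "uniform_limit UNIV u l sequentially"
    using uniformly_convergent_eq_cauchy[of "\<lambda>_. True" u]
    unfolding uniform_limit_sequentially_iff by simp blast
  from uniform_limit_bcontfunE[OF this sequentially_bot] obtain l' where "u \<longlonglongrightarrow> l'" by metis
  then show "\<exists>l\<in>UNIV. u \<longlonglongrightarrow> l" by blast
qed

section \<open>Solution operators on a space of histories\<close>

locale history_space =
  fixes entries :: "'b::banach \<Rightarrow> nat \<Rightarrow> 'a::banach"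
    and J :: real and K M :: "nat \<Rightarrow> real"
  assumes phase: "phase_space entries J K M"
begin

lemma inj_entries: "inj entries"
  and linear_entries: "linear (\<lambda>\<phi>. entries \<phi> k)"
  and K_nonneg: "K n \<ge> 0"
  using phase unfolding phase_space_def sequence_space_def by auto

text \<open>
  One time step: the history moves one place into the past and \<open>v\<close> becomes the present value.
\<close>

definition prepend :: "'b \<Rightarrow> 'a \<Rightarrow> 'b" where
  "prepend \<phi> v = inv entries (case_nat v (entries \<phi>))"

lemma hist_Suc: "hist x (Suc m) = case_nat (x (int m + 1)) (hist x m)"
proof
  fix k show "hist x (Suc m) k = case_nat (x (int m + 1)) (hist x m) k"
    by (cases k) (auto simp: hist_def add.commute)
qed

lemma entries_zero: "entries 0 k = 0"
  and entries_add: "entries (\<phi> + \<psi>) k = entries \<phi> k + entries \<psi> k"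
  and entries_scaleR: "entries (r *\<^sub>R \<phi>) k = r *\<^sub>R entries \<phi> k"
  using linear_0[OF linear_entries[of k]] linear_add[OF linear_entries[of k]]
    linear_scale[OF linear_entries[of k]] by simp_all

lemma segment_eq: "hist x m = entries \<phi> \<Longrightarrow> segment entries x m = \<phi>"
  unfolding segment_def by (simp add: inv_f_f[OF inj_entries])

lemma
  assumes "hist x 0 \<in> range entries"
  shows hist_in_range: "hist x n \<in> range entries"
    and norm_segment_le: "norm (segment entries x n)
      \<le> K n * (SUP j\<in>{0..n}. norm (x (int j))) + M n * norm (segment entries x 0)"
  using phase assms unfolding phase_space_def by simp_all

text \<open>
  The witness that lets the axioms of a phase space speak about \<open>prepend \<phi> v\<close>: a two-sided sequence
  with past \<open>\<phi>\<close> and value \<open>v\<close> at time 1.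
\<close>

lemma extension:
  defines "X \<equiv> \<lambda>\<phi> v j. if j = 1 then v else if j \<le> 0 then entries \<phi> (nat (- j)) else 0"
  shows "hist (X \<phi> v) 0 = entries \<phi>" and "hist (X \<phi> v) 1 = case_nat v (entries \<phi>)"
proof -
  show 0: "hist (X \<phi> v) 0 = entries \<phi>" unfolding X_def hist_def by (intro ext) auto
  show "hist (X \<phi> v) 1 = case_nat v (entries \<phi>)"
    using hist_Suc[of "X \<phi> v" 0] 0 by (simp add: X_def)
qed

lemma entries_prepend: "entries (prepend \<phi> v) = case_nat v (entries \<phi>)"
proof -
  have "case_nat v (entries \<phi>) \<in> range entries"
    unfolding extension(2)[symmetric] by (rule hist_in_range) (simp add: extension(1))
  then show ?thesis unfolding prepend_def by (rule f_inv_into_f)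
qed

lemma prepend_add: "prepend (\<phi> + \<psi>) (v + w) = prepend \<phi> v + prepend \<psi> w"
proof (rule injD[OF inj_entries], rule ext)
  fix k show "entries (prepend (\<phi> + \<psi>) (v + w)) k = entries (prepend \<phi> v + prepend \<psi> w) k"
    by (cases k) (simp_all only: entries_add entries_prepend nat.case)
qed

lemma prepend_scaleR: "prepend (r *\<^sub>R \<phi>) (r *\<^sub>R v) = r *\<^sub>R prepend \<phi> v"
proof (rule injD[OF inj_entries], rule ext)
  fix k show "entries (prepend (r *\<^sub>R \<phi>) (r *\<^sub>R v)) k = entries (r *\<^sub>R prepend \<phi> v) k"
    by (cases k) (simp_all only: entries_scaleR entries_prepend nat.case)
qed

abbreviation impulse :: "'a \<Rightarrow> 'b" where
  "impulse v \<equiv> prepend 0 v"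

lemma impulse_diff: "impulse (v - w) = impulse v - impulse w"
  using prepend_add[of 0 0 "v - w" w] by (simp add: algebra_simps)

text \<open>
  With zero past, the term of the phase space inequality that contains \<open>M\<close> vanishes.  The function
  \<open>K\<close> enters the estimates only through this bound, hence only with its value at 1.
\<close>

lemma norm_impulse_le: "norm (impulse v) \<le> K 1 * norm v"
proof -
  define x where "x = (\<lambda>j::int. if j = 1 then v else if j \<le> 0 then entries 0 (nat (- j)) else 0)"
  have x: "hist x 0 = entries 0" "hist x 1 = case_nat v (entries 0)"
    unfolding x_def by (rule extension)+
  have "segment entries x 0 = 0" by (rule segment_eq[OF x(1)])
  moreover have "segment entries x 1 = impulse v"
    by (rule segment_eq) (simp add: x(2) entries_prepend del: One_nat_def)
  ultimately have "norm (impulse v)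
      \<le> K 1 * (SUP j\<in>{0..1}. norm (x (int j))) + M 1 * norm (0 :: 'b)"
    using norm_segment_le[of x 1] x(1) by simp
  also have "(\<lambda>j. norm (x (int j))) ` {0..1::nat} = {0, norm v}"
  proof -
    have "{0..1::nat} = {0, 1}" by auto
    then show ?thesis by (simp add: x_def entries_zero)
  qed
  also have "Sup {0, norm v} = norm v"
    by (subst cSup_eq_Max) auto
  finally show ?thesis by simp
qed

lemma trivial_if_K_zero:
  assumes "K 1 = 0"
  shows "\<phi> = (\<psi> :: 'b)"
proof -
  have "v = 0" for v :: 'a
  proof -
    have "impulse v = 0" using norm_impulse_le[of v] assms by simp
    then have "entries (impulse v) 0 = 0" by (simp add: entries_zero)
    then show ?thesis by (simp add: entries_prepend)
  qed
  then have "entries \<phi> k = entries \<psi> k" for k by metis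
  then have "entries \<phi> = entries \<psi>" by (rule ext)
  then show ?thesis by (rule injD[OF inj_entries])
qed

primrec orbit :: "(nat \<Rightarrow> 'b \<Rightarrow> 'a) \<Rightarrow> nat \<Rightarrow> 'b \<Rightarrow> nat \<Rightarrow> 'b" where
  "orbit g n \<phi> 0 = \<phi>"
| "orbit g n \<phi> (Suc i) = prepend (orbit g n \<phi> i) (g (n + i) (orbit g n \<phi> i))"

lemma hist_solution:
  assumes "hist x n = entries \<phi>" and "\<forall>m\<ge>n. x (int m + 1) = g m (segment entries x m)"
  shows "hist x (n + i) = entries (orbit g n \<phi> i)"
proof (induction i)
  case (Suc i)
  then have "x (int (n + i) + 1) = g (n + i) (orbit g n \<phi> i)"
    using assms(2) segment_eq[OF Suc.IH] by (metis le_add1)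
  then show ?case using Suc hist_Suc[of x "n + i"] by (simp add: entries_prepend)
qed (use assms in simp)

text \<open>
  Replaces the definite description of the solution by iteration of \<open>prepend\<close>: the orbit determines
  every segment from time \<open>n\<close> on, and with the initial history these fix the whole sequence.
\<close>

lemma sol_op_eq_orbit:
  assumes "n \<le> m"
  shows "sol_op entries g m n \<phi> = orbit g n \<phi> (m - n)"
proof -
  define sol where "sol x \<longleftrightarrow> hist x n = entries \<phi> \<and>
    (\<forall>m\<ge>n. x (int m + 1) = g m (segment entries x m))" for x
  define x where "x j = (if j \<le> int n then entries \<phi> (nat (int n - j))
    else entries (orbit g n \<phi> (nat j - n)) 0)" for j
  have hx: "hist x (n + i) = entries (orbit g n \<phi> i)" for i
  proof (induction i)
    case 0
    show ?case by (rule ext) (simp add: hist_def x_def)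
  next
    case (Suc i)
    have "nat (int n + int i + 1) - n = Suc i" by simp
    then have "x (int (n + i) + 1) = g (n + i) (orbit g n \<phi> i)"
      unfolding x_def by (simp add: entries_prepend)
    then show ?case using Suc hist_Suc[of x "n + i"] by (simp add: entries_prepend)
  qed
  have "x (int m + 1) = g m (segment entries x m)" if "n \<le> m" for m
  proof -
    have "segment entries x m = orbit g n \<phi> (m - n)"
      by (rule segment_eq) (use hx[of "m - n"] that in simp)
    moreover have "nat (int m + 1) - n = Suc (m - n)" using that by simp
    ultimately show ?thesis unfolding x_def using that by (simp add: entries_prepend)
  qed
  then have "sol x" unfolding sol_def using hx[of 0] by simp
  moreover have "y = x" if "sol y" for y
  proof
    fix j
    have eq: "hist y (n + i) = hist x (n + i)" for i
      using hist_solution[of y n \<phi> g i] that unfolding sol_def hx by blast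
    show "y j = x j"
    proof (cases "j \<le> int n")
      case True
      then show ?thesis using fun_cong[OF eq[of 0], of "nat (int n - j)"] by (simp add: hist_def)
    next
      case False
      then show ?thesis using fun_cong[OF eq[of "nat j - n"], of 0] by (simp add: hist_def)
    qed
  qed
  ultimately have "(THE x. sol x) = x" by (rule the_equality)
  then have "solution entries g n \<phi> = x" unfolding solution_def sol_def .
  moreover have "hist x m = entries (orbit g n \<phi> (m - n))" using hx[of "m - n"] assms by simp
  ultimately show ?thesis unfolding sol_op_def by (simp add: segment_eq)
qed

lemma sol_op_refl: "sol_op entries g n n \<phi> = \<phi>"
  by (simp add: sol_op_eq_orbit)

lemma sol_op_Suc:
  assumes "n \<le> m"
  shows "sol_op entries g (Suc m) n \<phi>
    = prepend (sol_op entries g m n \<phi>) (g m (sol_op entries g m n \<phi>))"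
  using assms by (simp add: sol_op_eq_orbit Suc_diff_le)

lemma sol_op_comp:
  assumes "n \<le> m" "m \<le> k"
  shows "sol_op entries g k m (sol_op entries g m n \<phi>) = sol_op entries g k n \<phi>"
  using assms(2)
proof (induction k rule: dec_induct)
  case base
  then show ?case by (rule sol_op_refl)
next
  case (step k)
  then show ?case using assms(1) by (simp add: sol_op_Suc)
qed

lemma linear_sol_op:
  assumes "\<And>m. linear (g m)" "n \<le> m"
  shows "linear (sol_op entries g m n)"
  using assms(2)
proof (induction m rule: dec_induct)
  case base
  show ?case by (simp add: sol_op_refl linear_iff)
next
  case (step m)
  show ?case
    by (rule linearI) (simp_all add: sol_op_Suc step.hyps linear_add[OF step.IH]
      linear_scale[OF step.IH] linear_add[OF assms(1)] linear_scale[OF assms(1)]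
      prepend_add prepend_scaleR)
qed

end

section \<open>Evolution along the kernels of the projections\<close>

locale split_evolution = history_space entries J K M
  for entries :: "'b::banach \<Rightarrow> nat \<Rightarrow> 'a::banach"
    and J :: real and K M :: "nat \<Rightarrow> real" +
  fixes A :: "nat \<Rightarrow> 'b \<Rightarrow> 'a" and P :: "nat \<Rightarrow> 'b \<Rightarrow> 'b"
  assumes A_linear: "linear (A m)"
    and P_bounded_linear: "bounded_linear (P n)"
    and P_idem: "P n (P n \<phi>) = P n \<phi>"
    and invertible: "n \<le> m \<Longrightarrow> bij_betw (sol_op entries A m n) (ker (P n)) (ker (P m))"
begin

abbreviation W :: "nat \<Rightarrow> nat \<Rightarrow> 'b \<Rightarrow> 'b" where "W \<equiv> sol_op entries A"
abbreviation U :: "nat \<Rightarrow> nat \<Rightarrow> 'b \<Rightarrow> 'b" where "U \<equiv> lin_op entries A P"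
abbreviation G :: "nat \<Rightarrow> nat \<Rightarrow> 'b \<Rightarrow> 'b" where "G \<equiv> green entries A P"
abbreviation Q :: "nat \<Rightarrow> 'b \<Rightarrow> 'b" where "Q \<equiv> compl_proj P"
abbreviation F :: "nat \<Rightarrow> 'b set" where "F n \<equiv> ker (P n)"

text \<open>
  The evolution along the kernels, extended to the whole space by \<open>Q\<^sub>n\<close> so that it can be treated
  as a linear operator for all pairs of times, forward and backward.
\<close>

definition V :: "nat \<Rightarrow> nat \<Rightarrow> 'b \<Rightarrow> 'b" where
  "V m n \<phi> = U m n (Q n \<phi>)"

lemma linear_P: "linear (P n)"
  using P_bounded_linear by (rule bounded_linear.linear)

lemma linear_W: "n \<le> m \<Longrightarrow> linear (W m n)"
  by (rule linear_sol_op[OF A_linear])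

lemma bounded_linear_Q: "bounded_linear (Q n)"
  unfolding compl_proj_def[abs_def]
  by (intro bounded_linear_sub bounded_linear_ident P_bounded_linear)

lemma linear_Q: "linear (Q n)"
  using bounded_linear_Q by (rule bounded_linear.linear)

lemma Q_in_F: "Q n \<phi> \<in> F n"
  by (simp add: ker_def compl_proj_def linear_diff[OF linear_P] P_idem)

lemma Q_ident: "\<phi> \<in> F n \<Longrightarrow> Q n \<phi> = \<phi>"
  by (simp add: ker_def compl_proj_def)

lemma compl_space_eq_F: "compl_space P n = F n"
proof
  show "compl_space P n \<subseteq> F n" unfolding compl_space_def using Q_in_F by (rule image_subsetI)
  show "F n \<subseteq> compl_space P n"
  proof
    fix \<phi> assume "\<phi> \<in> F n"
    then have "\<phi> = Q n \<phi>" by (simp add: Q_ident)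
    then show "\<phi> \<in> compl_space P n" unfolding compl_space_def by (rule range_eqI)
  qed
qed

lemma subspace_F: "subspace (F n)"
  unfolding ker_def by (rule linear_subspace_kernel[OF linear_P])

lemma closed_F: "closed (F n)"
proof -
  have "F n = P n -` {0}" by (auto simp: ker_def)
  moreover have "continuous_on UNIV (P n)"
    using P_bounded_linear by (rule linear_continuous_on)
  ultimately show ?thesis by (simp add: closed_vimage)
qed

lemma W_in_F: "n \<le> m \<Longrightarrow> \<phi> \<in> F n \<Longrightarrow> W m n \<phi> \<in> F m"
  using bij_betwE[OF invertible] by blast

lemma W_inj: "n \<le> m \<Longrightarrow> \<phi> \<in> F n \<Longrightarrow> \<psi> \<in> F n \<Longrightarrow> W m n \<phi> = W m n \<psi> \<Longrightarrow> \<phi> = \<psi>"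
  using bij_betw_imp_inj_on[OF invertible] by (rule inj_onD)

lemma U_in_F:
  assumes "\<phi> \<in> F n" shows "U m n \<phi> \<in> F m"
proof (cases "n \<le> m")
  case True
  then show ?thesis using W_in_F assms by (simp add: lin_op_def)
next
  case False
  then have "\<phi> \<in> W n m ` F m" using assms bij_betw_imp_surj_on[OF invertible[of m n]] by simp
  then show ?thesis using False by (simp add: lin_op_def inv_into_into)
qed

text \<open>
  Pushing forward to a common later time \<open>N\<close> turns the backward operators into forward ones.  As the
  push is injective on the kernels, identities for \<open>U\<close> can be checked at time \<open>N\<close>; this avoids
  distinguishing cases by the order of the times.
\<close>

lemma W_U:
  assumes "\<phi> \<in> F n" "n \<le> N" "m \<le> N"
  shows "W N m (U m n \<phi>) = W N n \<phi>"
proof (cases "n \<le> m")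
  case True
  then show ?thesis using assms by (simp add: lin_op_def sol_op_comp)
next
  case False
  then have "\<phi> \<in> W n m ` F m"
    using assms(1) bij_betw_imp_surj_on[OF invertible[of m n]] by simp
  then have "W n m (U m n \<phi>) = \<phi>" using False by (simp add: lin_op_def f_inv_into_f)
  then show ?thesis using sol_op_comp[of m n N A "U m n \<phi>"] False assms by simp
qed

lemma U_eqI:
  assumes "\<phi> \<in> F n" "\<psi> \<in> F m" "n \<le> N" "m \<le> N" "W N m \<psi> = W N n \<phi>"
  shows "U m n \<phi> = \<psi>"
  using W_inj[of m N "U m n \<phi>" \<psi>] assms W_U U_in_F by simp

lemma U_comp:
  assumes "\<phi> \<in> F n" shows "U k m (U m n \<phi>) = U k n \<phi>"
proof -
  define N where "N = max k (max m n)"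
  have "U k n \<phi> = U k m (U m n \<phi>)"
    by (rule U_eqI[of _ _ _ _ N]) (use assms in \<open>simp_all add: U_in_F W_U N_def\<close>)
  then show ?thesis by simp
qed

lemma V_in_F: "V m n \<phi> \<in> F m"
  unfolding V_def by (intro U_in_F Q_in_F)

lemma V_eq_U: "\<phi> \<in> F n \<Longrightarrow> V m n \<phi> = U m n \<phi>"
  by (simp add: V_def Q_ident)

lemma U_refl: "U n n \<phi> = \<phi>"
  by (simp add: lin_op_def sol_op_refl)

lemma V_comp: "V k m (V m n \<phi>) = V k n \<phi>"
  by (simp add: V_eq_U[OF V_in_F]) (simp add: V_def U_comp Q_in_F)

lemma V_refl: "V n n \<phi> = Q n \<phi>"
  by (simp add: V_def U_refl)

lemma linear_V: "linear (V m n)"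
proof (rule linearI)
  define N where "N = max m n"
  have N: "n \<le> N" "m \<le> N" by (auto simp: N_def)
  have W_V: "W N m (V m n \<phi>) = W N n (Q n \<phi>)" for \<phi>
    unfolding V_def using Q_in_F N by (rule W_U)
  note lin = linear_add[OF linear_W] linear_add[OF linear_Q]
    linear_scale[OF linear_W] linear_scale[OF linear_Q]
  fix \<phi> \<psi> :: 'b and r :: real
  show "V m n (\<phi> + \<psi>) = V m n \<phi> + V m n \<psi>"
    unfolding V_def[of m n "\<phi> + \<psi>"]
    by (rule U_eqI[OF Q_in_F _ N])
       (intro subspace_add[OF subspace_F] V_in_F, simp add: lin N W_V)
  show "V m n (r *\<^sub>R \<phi>) = r *\<^sub>R V m n \<phi>"
    unfolding V_def[of m n "r *\<^sub>R \<phi>"]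
    by (rule U_eqI[OF Q_in_F _ N])
       (intro subspace_scale[OF subspace_F] V_in_F, simp add: lin N W_V)
qed

lemma green_ge: "n \<le> m \<Longrightarrow> G m n \<phi> = W m n (P n \<phi>)"
  and green_less: "m < n \<Longrightarrow> G m n \<phi> = - V m n \<phi>"
  by (simp_all add: green_def lin_op_def V_def)

lemma linear_green: "linear (G m n)"
proof (cases "n \<le> m")
  case True
  then have "G m n = W m n \<circ> P n" by (auto simp: green_ge)
  then show ?thesis using linear_compose[OF linear_P linear_W[OF True]] by simp
next
  case False
  then have "G m n = (\<lambda>\<phi>. - V m n \<phi>)" by (auto simp: green_less)
  then show ?thesis using linear_compose_neg[OF linear_V] by simp
qed

lemma W_V_Suc: "W (Suc m) m (V m n \<phi>) = V (Suc m) n \<phi>"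
proof -
  have "W (Suc m) m (V m n \<phi>) = V (Suc m) m (V m n \<phi>)"
    by (simp add: V_eq_U[OF V_in_F] lin_op_def)
  then show ?thesis by (simp add: V_comp)
qed

text \<open>
  The Green operator solves the homogeneous equation except for a jump: at \<open>k = m\<close> the branch changes
  from \<open>- Q\<close> to \<open>P\<close>, and \<open>P + Q\<close> is the identity.
\<close>

lemma W_green_Suc:
  "W (Suc m) m (G m (Suc k) x) = G (Suc m) (Suc k) x - (if k = m then x else 0)"
proof -
  consider "k < m" | "k = m" | "k > m" by linarith
  then show ?thesis
  proof cases
    case 1
    then show ?thesis by (simp add: green_ge sol_op_comp)
  next
    case 2
    then show ?thesis
      by (simp add: green_ge green_less sol_op_refl linear_neg[OF linear_W] W_V_Suc V_refl
          compl_proj_def)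
  next
    case 3
    then show ?thesis by (simp add: green_less linear_neg[OF linear_W] W_V_Suc)
  qed
qed

section \<open>Bounds and series for the Green operator\<close>

definition green_norm :: "nat \<Rightarrow> nat \<Rightarrow> real" where
  "green_norm m k = enn2real (op_norm (G m (Suc k)))"

lemma green_norm_nonneg: "green_norm m k \<ge> 0"
  by (simp add: green_norm_def)

lemma
  assumes d: "\<And>n. d n > 0" and finite: "green_sup entries A P d < top"
  shows op_norm_green_finite: "op_norm (G m (Suc k)) < top"
    and summable_green_norm: "summable (\<lambda>k. d k * green_norm m k)"
    and suminf_green_norm_le: "(\<Sum>k. d k * green_norm m k) \<le> enn2real (green_sup entries A P d)"
proof -
  have le: "(\<Sum>k. ennreal (d k) * op_norm (G m (Suc k))) \<le> green_sup entries A P d"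
    unfolding green_sup_def by (rule SUP_upper2[of m]) auto
  then have fin: "(\<Sum>k. ennreal (d k) * op_norm (G m (Suc k))) < top"
    using finite by (rule le_less_trans)
  have op: "op_norm (G m (Suc k)) < top" for k
  proof (rule ccontr)
    assume "\<not> op_norm (G m (Suc k)) < top"
    then have "ennreal (d k) * op_norm (G m (Suc k)) = top"
      using d[of k] by (simp add: ennreal_mult_top less_top[symmetric])
    moreover have "ennreal (d k) * op_norm (G m (Suc k)) \<le> (\<Sum>k. ennreal (d k) * op_norm (G m (Suc k)))"
      using sum_le_suminf[of "\<lambda>k. ennreal (d k) * op_norm (G m (Suc k))" "{k}"] by simp
    ultimately show False using fin by (simp add: top_unique)
  qed
  then show "op_norm (G m (Suc k)) < top" .
  have eq: "ennreal (d k) * op_norm (G m (Suc k)) = ennreal (d k * green_norm m k)" for k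
    using op[of k] d[of k] by (simp add: green_norm_def ennreal_mult)
  have nonneg: "0 \<le> d k * green_norm m k" for k
    using d[of k] green_norm_nonneg[of m k] by simp
  show sm: "summable (\<lambda>k. d k * green_norm m k)"
    using fin nonneg unfolding eq by (intro summable_suminf_not_top) auto
  have "ennreal (\<Sum>k. d k * green_norm m k) \<le> green_sup entries A P d"
    using le unfolding eq suminf_ennreal2[OF nonneg sm] .
  then show "(\<Sum>k. d k * green_norm m k) \<le> enn2real (green_sup entries A P d)"
    using finite by (cases "green_sup entries A P d") (auto simp: ennreal_le_iff)
qed

end

locale green_bounded = split_evolution entries J K M A P
  for entries :: "'b::banach \<Rightarrow> nat \<Rightarrow> 'a::banach"
    and J :: real and K M :: "nat \<Rightarrow> real"
    and A :: "nat \<Rightarrow> 'b \<Rightarrow> 'a" and P :: "nat \<Rightarrow> 'b \<Rightarrow> 'b" +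
  assumes op_norm_green: "op_norm (green entries A P m (Suc k)) < top"
begin

lemma norm_green_le: "norm (G m (Suc k) x) \<le> green_norm m k * norm x"
  unfolding green_norm_def by (rule op_norm_le[OF linear_green op_norm_green])

lemma bounded_linear_green: "bounded_linear (G m (Suc k))"
  by (rule bounded_linear_if_op_norm_finite[OF linear_green op_norm_green])

lemma bounded_linear_V_backward:
  assumes "m < n" shows "bounded_linear (V m n)"
proof -
  obtain k where k: "n = Suc k" using assms by (cases n) auto
  have "V m n = (\<lambda>\<phi>. - G m (Suc k) \<phi>)" using assms k by (auto simp: green_less)
  then show ?thesis using bounded_linear_minus[OF bounded_linear_green] by simp
qed

text \<open>
  Backward in time \<open>V\<close> is minus a Green operator, hence bounded.  Forward in time it inverts the
  backward operator, whose range \<open>F n\<close> is closed, and the open mapping theorem applies.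
\<close>

lemma bounded_linear_V: "bounded_linear (V m n)"
proof (cases "n < m")
  case True
  have range_eq: "range (V n m) = F n"
  proof
    show "range (V n m) \<subseteq> F n" using V_in_F by blast
    show "F n \<subseteq> range (V n m)"
    proof
      fix \<phi> assume "\<phi> \<in> F n"
      then have "\<phi> = V n m (V m n \<phi>)" by (simp add: V_comp V_refl Q_ident)
      then show "\<phi> \<in> range (V n m)" by (rule range_eqI)
    qed
  qed
  obtain C where C: "\<And>y. y \<in> F n \<Longrightarrow> \<exists>x. V n m x = y \<and> norm x \<le> C * norm y"
    using bounded_linear_preimage_bound[OF bounded_linear_V_backward[OF True]] closed_F[of n]
    unfolding range_eq by blast
  obtain B where B: "B \<ge> 0" "\<And>x. norm (Q m x) \<le> norm x * B"
    using bounded_linear.nonneg_bounded[OF bounded_linear_Q] by blast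
  have bound: "norm (V m n \<phi>) \<le> norm (Q n \<phi>) * (C * B)" for \<phi>
  proof -
    obtain x where x: "V n m x = Q n \<phi>" "norm x \<le> C * norm (Q n \<phi>)"
      using C[OF Q_in_F] by blast
    have "V m n \<phi> = V m n (Q n \<phi>)" by (simp add: V_def Q_ident[OF Q_in_F])
    also have "\<dots> = Q m x" unfolding x(1)[symmetric] by (simp add: V_comp V_refl)
    finally have "norm (V m n \<phi>) \<le> norm x * B" using B(2) by simp
    also have "\<dots> \<le> C * norm (Q n \<phi>) * B" using x(2) B(1) by (rule mult_right_mono)
    finally show ?thesis by (simp add: mult_ac)
  qed
  obtain B' where B': "\<And>x. norm (Q n x) \<le> norm x * B'"
    using bounded_linear.bounded[OF bounded_linear_Q] by blast
  have "norm (V m n \<phi>) \<le> norm \<phi> * (B' * \<bar>C * B\<bar>)" for \<phi>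
  proof -
    have "norm (V m n \<phi>) \<le> norm (Q n \<phi>) * \<bar>C * B\<bar>"
      by (rule order_trans[OF bound]) (intro mult_left_mono, auto)
    also have "\<dots> \<le> norm \<phi> * B' * \<bar>C * B\<bar>" using B' by (rule mult_right_mono) simp
    finally show ?thesis by (simp add: mult_ac)
  qed
  then show ?thesis
    using linear_V by (intro bounded_linear.intro bounded_linear_axioms.intro) auto
next
  case False
  then consider "m = n" | "m < n" by linarith
  then show ?thesis
  proof cases
    case 1
    then have "V m n = Q n" by (auto simp: V_refl)
    then show ?thesis by (simp add: bounded_linear_Q)
  qed (rule bounded_linear_V_backward)
qed

text \<open>
  The linear solution operator may be unbounded, so it cannot simply be applied termwise to the
  series.  All but finitely many terms and the tail that they sum to lie in the closed subspace
  \<open>F m\<close>, on which the operator agrees with the bounded operator \<open>V (Suc m) m\<close>.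
\<close>

lemma green_series_step:
  assumes sm: "summable (\<lambda>k. G m (Suc k) (g k))"
    and sm': "summable (\<lambda>k. G (Suc m) (Suc k) (g k))"
  shows "W (Suc m) m (\<Sum>k. G m (Suc k) (g k)) + g m = (\<Sum>k. G (Suc m) (Suc k) (g k))"
proof -
  let ?W = "W (Suc m) m" and ?a = "\<lambda>k. G m (Suc k) (g k)"
  have lin: "linear ?W" by (rule linear_W) simp
  define t where "t = (\<Sum>k. ?a (k + m))"
  have sm_tail: "summable (\<lambda>k. ?a (k + m))" using sm by (rule summable_ignore_initial_segment)
  have tail_V: "?a (k + m) = V m (Suc (k + m)) (- g (k + m))" for k
    by (simp add: green_less linear_neg[OF linear_V])
  have t: "t \<in> F m"
    unfolding t_def
  proof (rule closed_sequentially[OF closed_F[of m]])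
    show "(\<Sum>k<n. ?a (k + m)) \<in> F m" for n
      unfolding tail_V by (intro subspace_sum[OF subspace_F] V_in_F)
    show "(\<lambda>n. \<Sum>k<n. ?a (k + m)) \<longlonglongrightarrow> (\<Sum>k. ?a (k + m))"
      using sm_tail by (rule summable_LIMSEQ)
  qed
  have W_on_F: "?W x = V (Suc m) m x" if "x \<in> F m" for x
    using that by (simp add: V_eq_U lin_op_def)
  have "?W (?a (k + m)) = V (Suc m) m (?a (k + m))" for k
    unfolding tail_V by (rule W_on_F[OF V_in_F])
  moreover have "(\<lambda>k. V (Suc m) m (?a (k + m))) sums V (Suc m) m t"
    unfolding t_def by (rule bounded_linear.sums[OF bounded_linear_V summable_sums[OF sm_tail]])
  ultimately have "(\<lambda>k. ?W (?a (k + m))) sums ?W t" using W_on_F[OF t] by simp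
  then have "(\<lambda>k. ?W (?a k)) sums (?W t + (\<Sum>k<m. ?W (?a k)))"
    by (rule iffD1[OF sums_iff_shift[of "\<lambda>k. ?W (?a k)" m]])
  also have "?W t + (\<Sum>k<m. ?W (?a k)) = ?W (\<Sum>k. ?a k)"
    unfolding t_def suminf_split_initial_segment[OF sm, of m]
    by (simp add: linear_add[OF lin] linear_sum[OF lin])
  finally have 1: "(\<lambda>k. ?W (?a k)) sums ?W (\<Sum>k. ?a k)" .
  have "(\<lambda>k. if k = m then g k else 0) sums g m" by (rule sums_single)
  then have "(\<lambda>k. G (Suc m) (Suc k) (g k) - (if k = m then g k else 0)) sums
      ((\<Sum>k. G (Suc m) (Suc k) (g k)) - g m)"
    by (intro sums_diff summable_sums[OF sm'])
  moreover have "?W (?a k) = G (Suc m) (Suc k) (g k) - (if k = m then g k else 0)" for k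
    by (simp add: W_green_Suc)
  ultimately have "(\<lambda>k. ?W (?a k)) sums ((\<Sum>k. G (Suc m) (Suc k) (g k)) - g m)" by simp
  from sums_unique2[OF 1 this] show ?thesis by simp
qed

text \<open>
  The start \<open>w\<close> is recovered from its orbit at time \<open>k + 1\<close> by a Green operator whose norm tends
  to 0 as \<open>k\<close> grows.
\<close>

lemma bounded_orbit_zero:
  assumes sm: "summable (\<lambda>k. green_norm n k)"
    and w: "w \<in> F n" and bd: "\<And>m. n \<le> m \<Longrightarrow> norm (U m n w) \<le> B"
  shows "w = 0"
proof -
  have "norm w \<le> green_norm n k * B" if "n \<le> k" for k
  proof -
    have "w = V n (Suc k) (U (Suc k) n w)"
      using w by (simp add: V_eq_U U_in_F U_comp U_refl)
    also have "norm \<dots> = norm (G n (Suc k) (U (Suc k) n w))" using that by (simp add: green_less)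
    also have "\<dots> \<le> green_norm n k * norm (U (Suc k) n w)" by (rule norm_green_le)
    also have "\<dots> \<le> green_norm n k * B"
      using bd[of "Suc k"] that green_norm_nonneg by (intro mult_left_mono) auto
    finally show ?thesis .
  qed
  moreover have "(\<lambda>k. green_norm n k * B) \<longlonglongrightarrow> 0 * B"
    by (intro tendsto_mult summable_LIMSEQ_zero[OF sm] tendsto_const)
  ultimately have "norm w \<le> 0 * B"
    by (intro LIMSEQ_le_const[of "\<lambda>k. green_norm n k * B"]) auto
  then show ?thesis by simp
qed

end

section \<open>Fixed points of the Green operator equation\<close>

locale semilinear_evolution = green_bounded entries J K M A P
  for entries :: "'b::banach \<Rightarrow> nat \<Rightarrow> 'a::banach"
    and J :: real and K M :: "nat \<Rightarrow> real"
    and A :: "nat \<Rightarrow> 'b \<Rightarrow> 'a" and P :: "nat \<Rightarrow> 'b \<Rightarrow> 'b" +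
  fixes f :: "nat \<Rightarrow> 'b \<Rightarrow> 'a" and c :: "nat \<Rightarrow> real" and q :: real
  assumes f_zero: "f m 0 = 0"
    and c_nonneg: "c m \<ge> 0"
    and f_lipschitz: "norm (f m \<phi> - f m \<psi>) \<le> c m * min 1 (norm (\<phi> - \<psi>))"
    and summable_c_green: "summable (\<lambda>k. c k * green_norm m k)"
    and suminf_c_green_le: "(\<Sum>k. c k * green_norm m k) \<le> q"
    and contraction: "K 1 * q < 1"
begin

lemma norm_f_le: "norm (f m \<phi>) \<le> c m"
proof -
  have "norm (f m \<phi>) \<le> c m * min 1 (norm \<phi>)" using f_lipschitz[of m \<phi> 0] by (simp add: f_zero)
  also have "\<dots> \<le> c m * 1" using c_nonneg by (intro mult_left_mono) auto
  finally show ?thesis by simp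
qed

lemma f_lipschitz': "norm (f m \<phi> - f m \<psi>) \<le> c m * norm (\<phi> - \<psi>)"
  by (rule order_trans[OF f_lipschitz]) (intro mult_left_mono c_nonneg, simp)

text \<open>
  A term of the series in the fixed point equation.  Using \<open>V\<close> instead of the linear evolution
  operator defines it for all \<open>\<phi>\<close> and not only on the kernels, so that the fixed point can be sought
  among the bounded continuous functions on the product of \<^typ>\<open>nat\<close> and the phase space.
\<close>

definition summand :: "(nat \<times> 'b \<Rightarrow> 'b) \<Rightarrow> nat \<Rightarrow> 'b \<Rightarrow> nat \<Rightarrow> 'b" where
  "summand \<eta> n \<phi> k = G n (Suc k) (impulse (f k (V k n \<phi> + \<eta> (k, V k n \<phi>))))"

lemma norm_green_impulse_le:
  assumes "norm v \<le> c k * r"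
  shows "norm (G n (Suc k) (impulse v)) \<le> K 1 * r * (c k * green_norm n k)"
proof -
  have "norm (impulse v) \<le> K 1 * (c k * r)"
    by (rule order_trans[OF norm_impulse_le]) (intro mult_left_mono assms K_nonneg)
  then have "norm (G n (Suc k) (impulse v)) \<le> green_norm n k * (K 1 * (c k * r))"
    by (rule order_trans[OF norm_green_le mult_left_mono[OF _ green_norm_nonneg]])
  then show ?thesis by (simp add: mult_ac)
qed

lemma summand_bound: "norm (summand \<eta> n \<phi> k) \<le> K 1 * (c k * green_norm n k)"
  unfolding summand_def using norm_green_impulse_le[of _ k 1] norm_f_le by simp

lemma summable_bound: "summable (\<lambda>k. K 1 * (c k * green_norm n k))"
  by (rule summable_mult[OF summable_c_green])

lemma summable_summand: "summable (summand \<eta> n \<phi>)"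
  by (rule summable_comparison_test'[OF summable_bound]) (rule summand_bound)

lemma norm_suminf_summand_le: "norm (\<Sum>k. summand \<eta> n \<phi> k) \<le> K 1 * q"
proof -
  have "norm (\<Sum>k. summand \<eta> n \<phi> k) \<le> (\<Sum>k. K 1 * (c k * green_norm n k))"
    by (rule norm_suminf_le[OF summand_bound summable_bound])
  also have "\<dots> = K 1 * (\<Sum>k. c k * green_norm n k)"
    by (rule suminf_mult[OF summable_c_green])
  also have "\<dots> \<le> K 1 * q" by (intro mult_left_mono suminf_c_green_le K_nonneg)
  finally show ?thesis .
qed

lemma continuous_f: "continuous_on UNIV (f m)"
proof -
  have "(c m)-lipschitz_on UNIV (f m)"
    by (rule lipschitz_onI) (use f_lipschitz' c_nonneg in \<open>auto simp: dist_norm\<close>)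
  then show ?thesis by (rule lipschitz_on_continuous_on)
qed

lemma continuous_impulse: "continuous_on UNIV impulse"
proof -
  have "(K 1)-lipschitz_on UNIV impulse"
    by (rule lipschitz_onI) (auto simp: dist_norm impulse_diff[symmetric] K_nonneg
        intro: norm_impulse_le[simplified])
  then show ?thesis by (rule lipschitz_on_continuous_on)
qed

text \<open>
  Each term is continuous, and the bound \<open>summand_bound\<close> does not depend on \<open>\<phi>\<close>, so the
  Weierstrass test applies.
\<close>

lemma continuous_suminf_summand:
  assumes \<eta>: "continuous_on UNIV \<eta>"
  shows "continuous_on UNIV (\<lambda>\<phi>. \<Sum>k. summand \<eta> n \<phi> k)"
proof -
  have V: "continuous_on UNIV (V k n)" for k
    using bounded_linear_V by (rule linear_continuous_on)
  have G: "continuous_on UNIV (G n (Suc k))" for k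
    using bounded_linear_green by (rule linear_continuous_on)
  have \<eta>V: "continuous_on UNIV (\<lambda>\<phi>. \<eta> (k, V k n \<phi>))" for k
    by (rule continuous_on_compose2[OF \<eta>]) (auto intro!: continuous_intros V)
  have fin: "continuous_on UNIV (\<lambda>\<phi>. summand \<eta> n \<phi> k)" for k
    unfolding summand_def
    by (rule continuous_on_compose2[OF G], rule continuous_on_compose2[OF continuous_impulse],
        rule continuous_on_compose2[OF continuous_f]) (auto intro!: continuous_intros V \<eta>V)
  have "uniform_limit UNIV (\<lambda>N \<phi>. \<Sum>k<N. summand \<eta> n \<phi> k) (\<lambda>\<phi>. \<Sum>k. summand \<eta> n \<phi> k)
      sequentially"
    by (rule Weierstrass_m_test[OF summand_bound summable_bound])
  then show ?thesis
    by (rule uniform_limit_theorem[rotated])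
       (auto intro!: always_eventually continuous_on_sum fin)
qed

definition green_map :: "((nat \<times> 'b) \<Rightarrow>\<^sub>C 'b) \<Rightarrow> ((nat \<times> 'b) \<Rightarrow>\<^sub>C 'b)" where
  "green_map \<eta> = Bcontfun (\<lambda>(n, \<phi>). \<Sum>k. summand (apply_bcontfun \<eta>) n \<phi> k)"

lemma apply_green_map:
  "apply_bcontfun (green_map \<eta>) (n, \<phi>) = (\<Sum>k. summand (apply_bcontfun \<eta>) n \<phi> k)"
proof -
  have "(\<lambda>(n, \<phi>). \<Sum>k. summand (apply_bcontfun \<eta>) n \<phi> k) \<in> bcontfun"
  proof (rule bcontfun_normI)
    show "continuous_on UNIV (\<lambda>(n, \<phi>). \<Sum>k. summand (apply_bcontfun \<eta>) n \<phi> k)"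
      by (rule continuous_on_nat_prod) (simp add: continuous_suminf_summand)
    show "norm (case x of (n, \<phi>) \<Rightarrow> \<Sum>k. summand (apply_bcontfun \<eta>) n \<phi> k) \<le> K 1 * q" for x
      by (cases x) (simp only: prod.case norm_suminf_summand_le)
  qed
  then show ?thesis unfolding green_map_def by (simp add: Bcontfun_inverse)
qed

lemma green_map_contraction: "dist (green_map \<eta>) (green_map \<theta>) \<le> K 1 * q * dist \<eta> \<theta>"
proof (rule dist_bound)
  fix x :: "nat \<times> 'b"
  obtain n \<phi> where x: "x = (n, \<phi>)" by (cases x)
  let ?s = "\<lambda>\<eta>. summand (apply_bcontfun \<eta>) n \<phi>"
  let ?b = "\<lambda>k. K 1 * dist \<eta> \<theta> * (c k * green_norm n k)"
  have diff: "norm (?s \<eta> k - ?s \<theta> k) \<le> ?b k" for k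
  proof -
    let ?\<psi> = "V k n \<phi>"
    have "norm (f k (?\<psi> + \<eta> (k, ?\<psi>)) - f k (?\<psi> + \<theta> (k, ?\<psi>)))
        \<le> c k * dist (\<eta> (k, ?\<psi>)) (\<theta> (k, ?\<psi>))"
      using f_lipschitz'[of k "?\<psi> + \<eta> (k, ?\<psi>)" "?\<psi> + \<theta> (k, ?\<psi>)"] by (simp add: dist_norm)
    also have "\<dots> \<le> c k * dist \<eta> \<theta>" by (intro mult_left_mono dist_bounded c_nonneg)
    finally show ?thesis
      unfolding summand_def linear_diff[OF linear_green, symmetric] impulse_diff[symmetric]
      by (rule norm_green_impulse_le)
  qed
  have sm: "summable ?b" by (rule summable_mult[OF summable_c_green])
  have "norm (\<Sum>k. ?s \<eta> k - ?s \<theta> k) \<le> suminf ?b" by (rule norm_suminf_le[OF diff sm])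
  also have "\<dots> = K 1 * dist \<eta> \<theta> * (\<Sum>k. c k * green_norm n k)"
    by (rule suminf_mult[OF summable_c_green])
  also have "\<dots> \<le> K 1 * dist \<eta> \<theta> * q"
    by (intro mult_left_mono suminf_c_green_le mult_nonneg_nonneg K_nonneg zero_le_dist)
  finally show "dist (green_map \<eta> x) (green_map \<theta> x) \<le> K 1 * q * dist \<eta> \<theta>"
    unfolding x apply_green_map dist_norm
    by (simp add: suminf_diff[OF summable_summand summable_summand] mult_ac)
qed

lemma green_map_fixed_point: obtains \<eta> where "green_map \<eta> = \<eta>"
proof -
  have "0 \<le> K 1 * q"
    using norm_suminf_summand_le[of "\<lambda>_. 0" 0 0] norm_ge_zero by (rule order_trans[rotated])
  then have "\<exists>!\<eta>. green_map \<eta> = \<eta>"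
    using Banach_fix[OF complete_bcontfun UNIV_not_empty _ contraction subset_UNIV, of green_map]
      green_map_contraction by simp
  then show thesis using that by blast
qed

text \<open>
  The inhomogeneities \<open>g\<close> obtained from the images \<open>u\<^sub>k\<close> of the linear orbit do not depend on the
  time at which \<open>\<eta>\<close> is evaluated, because the linear evolution composes.  Hence the series for
  \<open>\<eta>\<close> along the orbit all have the same \<open>g\<close>, and \<open>green_series_step\<close> links consecutive times.
\<close>

lemma fixed_point_conjugates:
  assumes fp: "green_map \<eta> = \<eta>" and nm: "n \<le> m" and \<phi>: "\<phi> \<in> F n"
  shows "U m n \<phi> + \<eta> (m, U m n \<phi>)
    = semilinear_op entries A f m n (\<phi> + \<eta> (n, \<phi>))"
proof -
  define u where "u k = U k n \<phi> + \<eta> (k, U k n \<phi>)" for k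
  define g where "g k = impulse (f k (u k))" for k
  have summand_eq: "summand \<eta> m (U m n \<phi>) = (\<lambda>k. G m (Suc k) (g k))" for m
    unfolding summand_def g_def u_def by (simp add: V_eq_U[OF U_in_F[OF \<phi>]] U_comp[OF \<phi>])
  have sm: "summable (\<lambda>k. G m (Suc k) (g k))" for m
    using summable_summand[of \<eta> m "U m n \<phi>"] unfolding summand_eq .
  have \<eta>_eq: "\<eta> (m, U m n \<phi>) = (\<Sum>k. G m (Suc k) (g k))" for m
    using apply_green_map[of \<eta> m "U m n \<phi>"] unfolding fp summand_eq .
  have u_Suc: "u (Suc m) = prepend (u m) (A m (u m) + f m (u m))" if "n \<le> m" for m
  proof -
    have "U (Suc m) n \<phi> = W (Suc m) m (U m n \<phi>)"
      using that by (simp add: lin_op_def sol_op_comp)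
    then have "u (Suc m) = W (Suc m) m (u m) + g m"
      unfolding u_def[of "Suc m"] u_def[of m] \<eta>_eq
      by (simp add: linear_add[OF linear_W] green_series_step[OF sm sm, symmetric])
    also have "W (Suc m) m (u m) = prepend (u m) (A m (u m))"
      by (simp add: sol_op_Suc sol_op_refl)
    also have "\<dots> + g m = prepend (u m) (A m (u m) + f m (u m))"
      unfolding g_def prepend_add[symmetric] by simp
    finally show ?thesis .
  qed
  have "u m = semilinear_op entries A f m n (u n)"
    using nm
  proof (induction m rule: dec_induct)
    case base
    show ?case by (simp add: semilinear_op_def sol_op_refl)
  next
    case (step m)
    then show ?case using u_Suc
      by (simp add: semilinear_op_def sol_op_Suc)
  qed
  then show ?thesis unfolding u_def by (simp add: U_refl)
qed

text \<open>
  Two points with the same image have linear orbits that stay within \<open>2 \<parallel>\<eta>\<parallel>\<close> of each other.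
\<close>

lemma fixed_point_inj:
  assumes fp: "green_map \<eta> = \<eta>" and sm: "summable (\<lambda>k. green_norm n k)"
  shows "inj_on (\<lambda>\<phi>. \<phi> + \<eta> (n, \<phi>)) (F n)"
proof (rule inj_onI)
  fix \<phi> \<psi> assume \<phi>: "\<phi> \<in> F n" and \<psi>: "\<psi> \<in> F n" and eq: "\<phi> + \<eta> (n, \<phi>) = \<psi> + \<eta> (n, \<psi>)"
  have "\<phi> - \<psi> = 0"
  proof (rule bounded_orbit_zero[OF sm])
    show "\<phi> - \<psi> \<in> F n" using subspace_F \<phi> \<psi> by (rule subspace_diff)
    fix m assume m: "n \<le> m"
    let ?u = "U m n \<phi>" and ?v = "U m n \<psi>"
    have "?u + \<eta> (m, ?u) = ?v + \<eta> (m, ?v)"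
      using fixed_point_conjugates[OF fp m \<phi>] fixed_point_conjugates[OF fp m \<psi>] eq by simp
    then have "?u - ?v = \<eta> (m, ?v) - \<eta> (m, ?u)" by (simp add: algebra_simps)
    moreover have "U m n (\<phi> - \<psi>) = ?u - ?v"
      using m by (simp add: lin_op_def linear_diff[OF linear_W])
    ultimately have "norm (U m n (\<phi> - \<psi>)) \<le> norm (\<eta> (m, ?v)) + norm (\<eta> (m, ?u))"
      using norm_triangle_ineq4 by simp
    then show "norm (U m n (\<phi> - \<psi>)) \<le> norm \<eta> + norm \<eta>"
      using norm_bounded[of \<eta> "(m, ?v)"] norm_bounded[of \<eta> "(m, ?u)"] by linarith
  qed
  then show "\<phi> = \<psi>" by simp
qed

end

section \<open>Conjugacy of the linear and semilinear equations\<close>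

theorem theorem2:
  fixes entries :: "'b::banach \<Rightarrow> nat \<Rightarrow> 'a::banach"
    and J :: real and K M :: "nat \<Rightarrow> real"
    and A f :: "nat \<Rightarrow> 'b \<Rightarrow> 'a"
    and P :: "nat \<Rightarrow> 'b \<Rightarrow> 'b"
    and c :: "nat \<Rightarrow> real"
  assumes phase: "phase_space entries J K M"
    and A_linear: "\<And>m. linear (A m)"
    and P_bounded_linear: "\<And>n. bounded_linear (P n)"
    and P_idem: "\<And>n \<phi>. P n (P n \<phi>) = P n \<phi>"
    and P_commute: "\<And>m n \<phi>. n \<le> m \<Longrightarrow>
      P m (sol_op entries A m n \<phi>) = sol_op entries A m n (P n \<phi>)"
    and invertible: "\<And>m n. n \<le> m \<Longrightarrow>
      bij_betw (sol_op entries A m n) (ker (P n)) (ker (P m))"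
    and f_zero: "\<And>m. f m 0 = 0"
    and c_pos: "\<And>m. c m > 0"
    and f_lipschitz: "\<And>m \<phi> \<psi>. norm (f m \<phi> - f m \<psi>) \<le> c m * min 1 (norm (\<phi> - \<psi>))"
    and small: "ennreal (K 1) * green_sup entries A P c < 1"
  shows "\<exists>\<eta> \<in> bcont_space P.
    (let h = (\<lambda>n \<phi>. \<phi> + \<eta> (n, \<phi>)) in
      (\<forall>m n. n \<le> m \<longrightarrow>
        (\<forall>\<phi> \<in> compl_space P n.
          h m (lin_op entries A P m n \<phi>) = semilinear_op entries A f m n (h n \<phi>))) \<and>
      ((\<exists>d>0. ennreal (K 1) * green_sup entries A P (\<lambda>_. d) < 1) \<longrightarrow>
        (\<forall>n. inj_on (h n) (compl_space P n))))"
proof (cases "K 1 = 0")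
  \<comment> \<open>the product with \<open>K 1\<close> is then 0 even if \<open>green_sup\<close> is infinite\<close>
  case True
  interpret history_space entries J K M by (rule history_space.intro[OF phase])
  have all_eq: "\<phi> = (\<psi> :: 'b)" for \<phi> \<psi> using True by (rule trivial_if_K_zero)
  show ?thesis
  proof (rule bexI[of _ "\<lambda>_. 0"])
    show "(\<lambda>_. 0) \<in> bcont_space P" unfolding bcont_space_def by (auto simp: image_constant_conv)
    show "let h = (\<lambda>n \<phi>. \<phi> + 0) in
      (\<forall>m n. n \<le> m \<longrightarrow>
        (\<forall>\<phi> \<in> compl_space P n.
          h m (lin_op entries A P m n \<phi>) = semilinear_op entries A f m n (h n \<phi>))) \<and>
      ((\<exists>d>0. ennreal (K 1) * green_sup entries A P (\<lambda>_. d) < 1) \<longrightarrow>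
        (\<forall>n. inj_on (h n) (compl_space P n)))"
      unfolding Let_def by (intro conjI impI allI ballI inj_onI all_eq)
  qed
next
  case False
  interpret split_evolution entries J K M A P
    by (rule split_evolution.intro[OF history_space.intro[OF phase]],
        rule split_evolution_axioms.intro)
       (fact A_linear P_bounded_linear P_idem invertible)+
  have K1: "K 1 > 0" using False K_nonneg[of 1] by simp
  note finite = ennreal_mult_less_one_finite[OF small K1]
  interpret semilinear_evolution entries J K M A P f c "enn2real (green_sup entries A P c)"
  proof unfold_locales
    show "op_norm (G m (Suc k)) < top" for m k
      using c_pos finite(1) by (rule op_norm_green_finite)
    show "summable (\<lambda>k. c k * green_norm m k)" for m
      using c_pos finite(1) by (rule summable_green_norm)
    show "(\<Sum>k. c k * green_norm m k) \<le> enn2real (green_sup entries A P c)" for m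
      using c_pos finite(1) by (rule suminf_green_norm_le)
    show "0 \<le> c m" for m using c_pos[of m] by simp
  qed (fact f_zero f_lipschitz finite(2))+
  obtain \<eta> where \<eta>: "green_map \<eta> = \<eta>" by (rule green_map_fixed_point)
  show ?thesis
  proof (rule bexI[of _ "apply_bcontfun \<eta>"])
    show "apply_bcontfun \<eta> \<in> bcont_space P"
      unfolding bcont_space_def
      by (auto intro: bounded_subset[OF bounded_apply_bcontfun])
    have "inj_on (\<lambda>\<phi>. \<phi> + \<eta> (n, \<phi>)) (F n)"
      if d: "d > 0" "ennreal (K 1) * green_sup entries A P (\<lambda>_. d) < 1" for d n
    proof (rule fixed_point_inj[OF \<eta>])
      have "summable (\<lambda>k. d * green_norm n k)"
        by (rule summable_green_norm) (use d ennreal_mult_less_one_finite[OF d(2) K1] in auto)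
      then show "summable (\<lambda>k. green_norm n k)" using d(1) by (simp add: summable_cmult_iff)
    qed
    then show "let h = (\<lambda>n \<phi>. \<phi> + \<eta> (n, \<phi>)) in
      (\<forall>m n. n \<le> m \<longrightarrow>
        (\<forall>\<phi> \<in> compl_space P n.
          h m (lin_op entries A P m n \<phi>) = semilinear_op entries A f m n (h n \<phi>))) \<and>
      ((\<exists>d>0. ennreal (K 1) * green_sup entries A P (\<lambda>_. d) < 1) \<longrightarrow>
        (\<forall>n. inj_on (h n) (compl_space P n)))"
      unfolding Let_def compl_space_eq_F using fixed_point_conjugates[OF \<eta>] by blast
  qed
qed

end
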